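(* Let $0<s\le 1$, let $N\ge 1$ be an integer and let $u^{N}$ be the solution of the semidiscrete Fourier–Galerkin problem: $u^{N}(t)\in S_{N}$, $$(iu^{N}_{t}-(-\partial_{xx})^{s}u^{N}+|u^{N}|^{2}u^{N},\varphi)=0\quad\text{for all }\varphi\in S_{N},\qquad u^{N}(0)=P_{N}u_{0}.$$ Then, while the solution $u^{N}$ exists, $$\frac{d}{dt}I_{1}(u^{N})=\frac{d}{dt}I_{2}(u^{N})=\frac{d}{dt}H(u^{N})=0 .$$
   Context: All functions are complex-valued and $2\pi$-periodic; $L^2=L^2(-\pi,\pi)$ has inner product $(u_1,u_2)=\int_{-\pi}^{\pi}u_1\overline{u_2}\,dx$. Fourier coefficients are $\widehat u(k)=\frac1{2\pi}\int_{-\pi}^{\pi}u(x)e^{-ikx}dx$, $k\in\mathbb Z$. $(-\partial_{xx})^{s}$ is the Fourier multiplier with symbol $|k|^{2s}$, and $|D|^{s}=(-\partial_{xx})^{s/2}$ has symbol $|k|^{s}$. $S_N=\mathrm{span}\{e^{ikx}:k\in\mathbb Z,\,-N\le k\le N\}$ and $P_N u=\sum_{|k|\le N}\widehat u(k)e^{ikx}$. The initial datum $u_0$ is smooth and $2\pi$-periodic. For $u=v+iw$ with $v,w$ real-valued, $$I_1(u)=\tfrac12\int_{-\pi}^{\pi}|u|^2dx,\quad I_2(u)=\tfrac12\int_{-\pi}^{\pi}(vw_x-wv_x)\,dx,\quad H(u)=\tfrac12\int_{-\pi}^{\pi}\big((|D|^sv)^2+(|D|^sw)^2-V(u)\big)dx,$$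 with $V(z)=|z|^4/2$. *)

theory Defs
  imports "HOL-Analysis.Analysis"
begin

definition periodic_2pi :: "(real \<Rightarrow> complex) \<Rightarrow> bool" where
  "periodic_2pi u \<longleftrightarrow> (\<forall>x. u (x + 2 * pi) = u x)"

definition smooth :: "(real \<Rightarrow> complex) \<Rightarrow> bool" where
  "smooth u \<longleftrightarrow>
     (\<forall>n x. ((\<lambda>f y. vector_derivative f (at y)) ^^ n) u differentiable (at x))"

definition L2_inner :: "(real \<Rightarrow> complex) \<Rightarrow> (real \<Rightarrow> complex) \<Rightarrow> complex" where
  "L2_inner u1 u2 = (LBINT x:{-pi..pi}. u1 x * cnj (u2 x))"

definition fourier_mode :: "int \<Rightarrow> real \<Rightarrow> complex" where
  "fourier_mode k x = exp (\<i> * of_int k * of_real x)"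

definition fourier_coeff :: "(real \<Rightarrow> complex) \<Rightarrow> int \<Rightarrow> complex" where
  "fourier_coeff u k =
     1 / (2 * of_real pi) * (LBINT x:{-pi..pi}. u x * exp (- \<i> * of_int k * of_real x))"

definition fourier_multiplier ::
  "(int \<Rightarrow> real) \<Rightarrow> (real \<Rightarrow> complex) \<Rightarrow> real \<Rightarrow> complex" where
  "fourier_multiplier m u x =
     (\<Sum>\<^sub>\<infinity>k\<in>UNIV. of_real (m k) * fourier_coeff u k * fourier_mode k x)"

text \<open>For a positive exponent the symbols below vanish at \<open>k = 0\<close>, since \<open>0 powr a = 0\<close>.\<close>

definition frac_laplacian :: "real \<Rightarrow> (real \<Rightarrow> complex) \<Rightarrow> real \<Rightarrow> complex" where
  "frac_laplacian s = fourier_multiplier (\<lambda>k. \<bar>of_int k\<bar> powr (2 * s))"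

definition abs_D :: "real \<Rightarrow> (real \<Rightarrow> complex) \<Rightarrow> real \<Rightarrow> complex" where
  "abs_D s = fourier_multiplier (\<lambda>k. \<bar>of_int k\<bar> powr s)"

definition trig_space :: "nat \<Rightarrow> (real \<Rightarrow> complex) set" where
  "trig_space N =
     {\<phi>. \<exists>c :: int \<Rightarrow> complex. \<phi> = (\<lambda>x. \<Sum>k\<in>{-int N..int N}. c k * fourier_mode k x)}"

definition trig_proj :: "nat \<Rightarrow> (real \<Rightarrow> complex) \<Rightarrow> real \<Rightarrow> complex" where
  "trig_proj N u x = (\<Sum>k\<in>{-int N..int N}. fourier_coeff u k * fourier_mode k x)"

definition I1 :: "(real \<Rightarrow> complex) \<Rightarrow> real" where
  "I1 u = 1 / 2 * (LBINT x:{-pi..pi}. (cmod (u x))\<^sup>2)"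

definition I2 :: "(real \<Rightarrow> complex) \<Rightarrow> real" where
  "I2 u = (let v = (\<lambda>x. Re (u x)); w = (\<lambda>x. Im (u x))
           in 1 / 2 * (LBINT x:{-pi..pi}. v x * deriv w x - w x * deriv v x))"

definition V :: "complex \<Rightarrow> real" where
  "V z = (cmod z) ^ 4 / 2"

text \<open>The multiplier operators take values in the complex-valued functions, so the energy is
  complex-typed. It is a real number, because the even real symbol of \<^const>\<open>abs_D\<close> maps
  real-valued functions to real-valued functions.\<close>

definition energy :: "real \<Rightarrow> (real \<Rightarrow> complex) \<Rightarrow> complex" where
  "energy s u =
     (let v = (\<lambda>x. of_real (Re (u x))); w = (\<lambda>x. of_real (Im (u x)))
      in 1 / 2 * (LBINT x:{-pi..pi}. (abs_D s v x)\<^sup>2 + (abs_D s w x)\<^sup>2 - of_real (V (u x))))"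

text \<open>\<open>J\<close> is an interval of existence containing the initial time. The time derivative is taken
  within \<open>J\<close>, hence one-sided at end points belonging to \<open>J\<close>, and pointwise in \<open>x\<close>; on the
  finite-dimensional space \<^term>\<open>trig_space N\<close> this is the same as differentiability in any norm.\<close>

definition galerkin_solution ::
  "real \<Rightarrow> nat \<Rightarrow> (real \<Rightarrow> complex) \<Rightarrow> real set \<Rightarrow> (real \<Rightarrow> real \<Rightarrow> complex) \<Rightarrow> bool" where
  "galerkin_solution s N u0 J u \<longleftrightarrow>
     is_interval J \<and> 0 \<in> J \<and>
     (\<forall>t\<in>J. u t \<in> trig_space N) \<and>
     (\<exists>u'. (\<forall>t\<in>J. \<forall>x. ((\<lambda>\<tau>. u \<tau> x) has_vector_derivative u' t x) (at t within J)) \<and>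
           (\<forall>t\<in>J. \<forall>\<phi>\<in>trig_space N.
              L2_inner (\<lambda>x. \<i> * u' t x - frac_laplacian s (u t) x
                            + of_real ((cmod (u t x))\<^sup>2) * u t x) \<phi> = 0)) \<and>
     u 0 = trig_proj N u0"

end

theory Submission
  imports Defs
begin

text \<open>On trigonometric polynomials with coefficients \<open>c\<^sub>k\<close>, the mass, the momentum and the kinetic energy
  are the quadratic forms \<open>\<pi> \<Sum> m\<^sub>k \<bar>c\<^sub>k\<bar>\<^sup>2\<close> with \<open>m\<^sub>k = 1\<close>, \<open>k\<close> and \<open>\<bar>k\<bar>\<^sup>2\<^sup>s\<close>. Since \<open>S\<^sub>N\<close> is invariant under
  the relevant operators, the Galerkin equation can be tested with \<open>u\<close>, \<open>-i u\<^sub>x\<close> and \<open>u\<^sub>t\<close>, which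
  gives the three conservation laws. Equispaced quadrature is exact on trigonometric polynomials, so
  the coefficients and the integral of \<open>\<bar>u\<bar>\<^sup>4\<close> depend on finitely many point values of \<open>u\<close>, and their
  time derivatives follow from the pointwise ones.\<close>

section \<open>Fourier modes and integrals over a period\<close>

lemma fourier_mode_0 [simp]: "fourier_mode 0 x = 1"
  by (simp add: fourier_mode_def)

lemma fourier_mode_add: "fourier_mode (j + k) x = fourier_mode j x * fourier_mode k x"
  by (simp add: fourier_mode_def exp_add [symmetric] algebra_simps)

lemma fourier_mode_uminus: "fourier_mode (- k) x = cnj (fourier_mode k x)"
  by (simp add: fourier_mode_def exp_cnj)

lemma fourier_mode_diff: "fourier_mode (j - k) x = fourier_mode j x * cnj (fourier_mode k x)"
  using fourier_mode_add [of j "- k" x] by (simp add: fourier_mode_uminus)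

lemma continuous_on_fourier_mode [continuous_intros]: "continuous_on A (fourier_mode k)"
  unfolding fourier_mode_def by (intro continuous_intros)

text \<open>The complex derivative of z -> exp(ikz), restricted to the real axis.\<close>

lemma has_vector_derivative_fourier_mode:
  "(fourier_mode k has_vector_derivative \<i> * of_int k * fourier_mode k x) (at x within A)"
proof -
  have "((\<lambda>z. exp (\<i> * of_int k * z)) has_field_derivative \<i> * of_int k * fourier_mode k x)
          (at (of_real x))"
    unfolding fourier_mode_def by (auto intro!: derivative_eq_intros)
  from has_vector_derivative_real_field [OF this, of A]
  show ?thesis
    by (simp add: fourier_mode_def [abs_def])
qed

text \<open>The two values differ by the factor exp(2 pi i k) = 1. This periodicity removes the
  boundary terms whenever an antiderivative is evaluated over the period.\<close>

lemma fourier_mode_pi: "fourier_mode k pi = fourier_mode k (- pi)"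
proof -
  have "fourier_mode k (- pi) * exp (of_int k * (2 * of_real pi * \<i>)) = fourier_mode k pi"
    unfolding fourier_mode_def exp_add [symmetric] by (simp add: algebra_simps)
  moreover have "exp (of_int k * (2 * complex_of_real pi * \<i>)) = 1"
    using exp_integer_2pi [of "of_int k"] by (simp add: algebra_simps)
  ultimately show ?thesis by simp
qed

lemma integral_fourier_mode:
  "(LBINT x:{-pi..pi}. fourier_mode k x) = (if k = 0 then 2 * of_real pi else 0)"
proof (cases "k = 0")
  case True
  then show ?thesis
    by (simp add: set_lebesgue_integral_def scaleR_conv_of_real)
next
  case False
  define F where "F x = fourier_mode k x / (\<i> * of_int k)" for x
  have "(F has_vector_derivative fourier_mode k x) (at x within {-pi..pi})" for x
  proof -
    have "(F has_vector_derivative (\<i> * of_int k * fourier_mode k x) / (\<i> * of_int k))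
            (at x within {-pi..pi})"
      unfolding F_def
      by (intro has_vector_derivative_divide has_vector_derivative_fourier_mode)
    then show ?thesis
      using False by simp
  qed
  then have "(LBINT x:{-pi..pi}. fourier_mode k x) = F pi - F (- pi)"
    unfolding set_lebesgue_integral_def
    by (intro integral_FTC_atLeastAtMost continuous_intros) auto
  then show ?thesis
    using False by (simp add: F_def fourier_mode_pi)
qed

lemma set_integrable_continuous_period:
  fixes f :: "real \<Rightarrow> 'a::euclidean_space"
  assumes "continuous_on UNIV f"
  shows "set_integrable lborel {-pi..pi} f"
  by (rule borel_integrable_atLeastAtMost' [OF continuous_on_subset [OF assms]]) simp

lemma set_lebesgue_integral_sum:
  fixes f :: "'i \<Rightarrow> 'a \<Rightarrow> 'b::{banach, second_countable_topology}"
  assumes "\<And>i. i \<in> I \<Longrightarrow> set_integrable M A (f i)"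
  shows "(LINT x:A|M. \<Sum>i\<in>I. f i x) = (\<Sum>i\<in>I. LINT x:A|M. f i x)"
  using assms unfolding set_integrable_def set_lebesgue_integral_def
  by (simp add: scaleR_sum_right)

text \<open>Serves with \<open>T = Im\<close>, to move imaginary parts across the integral defining
  \<open>L2_inner\<close>.\<close>

lemma set_lebesgue_integral_bounded_linear:
  assumes "bounded_linear T" and "set_integrable M A f"
  shows "(LINT x:A|M. T (f x)) = T (LINT x:A|M. f x)"
proof -
  interpret bounded_linear T by fact
  show ?thesis
    using assms integral_bounded_linear [of T M "\<lambda>x. indicator A x *\<^sub>R f x"]
    unfolding set_integrable_def set_lebesgue_integral_def by (simp add: scaleR)
qed

section \<open>Trigonometric polynomials\<close>

text \<open>Entries of \<open>c\<close> with \<bar>k\<bar> > N are ignored, so the function does not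
  determine \<open>c\<close>; \<open>fourier_coeff\<close> later supplies a canonical
  choice.\<close>

definition trig_poly :: "nat \<Rightarrow> (int \<Rightarrow> complex) \<Rightarrow> real \<Rightarrow> complex" where
  "trig_poly N c x = (\<Sum>k\<in>{-int N..int N}. c k * fourier_mode k x)"

lemma trig_space_eq_range: "trig_space N = range (trig_poly N)"
  by (auto simp: trig_space_def trig_poly_def [abs_def])

lemma trig_poly_in_trig_space: "trig_poly N c \<in> trig_space N"
  by (simp add: trig_space_eq_range)

lemma continuous_on_trig_poly [continuous_intros]: "continuous_on A (trig_poly N c)"
  unfolding trig_poly_def [abs_def] by (intro continuous_intros)

lemma has_vector_derivative_trig_poly:
  "(trig_poly N c has_vector_derivative trig_poly N (\<lambda>k. \<i> * of_int k * c k) x) (at x within A)"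
proof -
  have "((\<lambda>x. \<Sum>k\<in>{-int N..int N}. c k * fourier_mode k x) has_vector_derivative
          (\<Sum>k\<in>{-int N..int N}. c k * (\<i> * of_int k * fourier_mode k x))) (at x within A)"
    by (intro has_vector_derivative_sum has_vector_derivative_mult_right
        has_vector_derivative_fourier_mode)
  then show ?thesis
    by (simp add: trig_poly_def [abs_def] algebra_simps)
qed

lemma cnj_trig_poly: "cnj (trig_poly N c x) = trig_poly N (\<lambda>k. cnj (c (- k))) x"
  unfolding trig_poly_def
  by (simp add: fourier_mode_uminus,
      rule sum.reindex_bij_witness [of _ uminus uminus]) (auto simp: fourier_mode_uminus)

lemma trig_poly_lincomb:
  "a * trig_poly N c x + b * trig_poly N d x = trig_poly N (\<lambda>k. a * c k + b * d k) x"
  by (simp add: trig_poly_def sum_distrib_left sum.distrib algebra_simps)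

lemma trig_space_add:
  "f \<in> trig_space N \<Longrightarrow> g \<in> trig_space N \<Longrightarrow> (\<lambda>x. f x + g x) \<in> trig_space N"
  using trig_poly_lincomb [of 1 N _ _ 1] by (auto simp: trig_space_eq_range)

lemma trig_space_sum:
  "(\<And>i. i \<in> I \<Longrightarrow> f i \<in> trig_space N) \<Longrightarrow> (\<lambda>x. \<Sum>i\<in>I. f i x) \<in> trig_space N"
proof (induction I rule: infinite_finite_induct)
  case (insert i I)
  then show ?case by (simp add: trig_space_add)
qed (auto simp: trig_space_def intro!: exI [of _ "\<lambda>_. 0"])

lemma trig_space_mode:
  assumes "\<bar>k\<bar> \<le> int N"
  shows "(\<lambda>x. a * fourier_mode k x) \<in> trig_space N"
proof -
  have "a * fourier_mode k x = trig_poly N (\<lambda>j. if j = k then a else 0) x" for x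
    using assms by (simp add: trig_poly_def if_distrib [of "\<lambda>z. z * _"] abs_le_iff cong: if_cong)
  then show ?thesis
    by (simp add: trig_poly_in_trig_space)
qed

text \<open>Degrees add because frequencies add. The resulting degree fixes how many quadrature
  nodes are needed below.\<close>

lemma trig_space_mult:
  assumes "f \<in> trig_space M" and "g \<in> trig_space N"
  shows "(\<lambda>x. f x * g x) \<in> trig_space (M + N)"
proof -
  obtain a b where ab: "f = trig_poly M a" "g = trig_poly N b"
    using assms by (auto simp: trig_space_eq_range)
  have "f x * g x = (\<Sum>j\<in>{-int M..int M}. \<Sum>k\<in>{-int N..int N}.
          (a j * b k) * fourier_mode (j + k) x)" for x
    by (simp add: ab trig_poly_def sum_product fourier_mode_add algebra_simps)
  moreover have "(\<lambda>x. \<Sum>j\<in>{-int M..int M}. \<Sum>k\<in>{-int N..int N}.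
          (a j * b k) * fourier_mode (j + k) x) \<in> trig_space (M + N)"
    by (intro trig_space_sum trig_space_mode) auto
  ultimately show ?thesis by simp
qed

lemma trig_space_cnj: "f \<in> trig_space N \<Longrightarrow> (\<lambda>x. cnj (f x)) \<in> trig_space N"
  by (auto simp: trig_space_eq_range cnj_trig_poly)

text \<open>Parseval's identity: by orthogonality of the modes only the diagonal of the double sum
  survives.\<close>

lemma L2_inner_trig_poly:
  "L2_inner (trig_poly N a) (trig_poly N b) =
     2 * of_real pi * (\<Sum>k\<in>{-int N..int N}. a k * cnj (b k))"
proof -
  have "L2_inner (trig_poly N a) (trig_poly N b) =
      (LBINT x:{-pi..pi}. \<Sum>j\<in>{-int N..int N}. \<Sum>k\<in>{-int N..int N}.
         (a j * cnj (b k)) * fourier_mode (j - k) x)"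
    by (simp add: L2_inner_def trig_poly_def sum_product fourier_mode_diff algebra_simps)
  also have "\<dots> = (\<Sum>j\<in>{-int N..int N}. \<Sum>k\<in>{-int N..int N}.
         (a j * cnj (b k)) * (LBINT x:{-pi..pi}. fourier_mode (j - k) x))"
    by (simp add: set_lebesgue_integral_sum set_integrable_continuous_period continuous_intros
        flip: set_integral_mult_right)
  also have "\<dots> = (\<Sum>j\<in>{-int N..int N}. a j * cnj (b j) * (2 * of_real pi))"
    by (simp add: integral_fourier_mode if_distrib [of "\<lambda>z. _ * z"] cong: if_cong)
  finally show ?thesis
    by (simp add: sum_distrib_left algebra_simps)
qed

lemma fourier_coeff_trig_poly:
  "fourier_coeff (trig_poly N c) k = (if \<bar>k\<bar> \<le> int N then c k else 0)"
proof -
  have "exp (- \<i> * of_int k * of_real x) = cnj (fourier_mode k x)" for x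
    by (simp add: fourier_mode_def exp_cnj)
  then have "(LBINT x:{-pi..pi}. trig_poly N c x * exp (- \<i> * of_int k * of_real x)) =
      (LBINT x:{-pi..pi}. \<Sum>j\<in>{-int N..int N}. c j * fourier_mode (j - k) x)"
    by (simp add: trig_poly_def sum_distrib_right fourier_mode_diff mult.assoc)
  also have "\<dots> = (\<Sum>j\<in>{-int N..int N}. c j * (LBINT x:{-pi..pi}. fourier_mode (j - k) x))"
    by (simp add: set_lebesgue_integral_sum set_integrable_continuous_period continuous_intros
        flip: set_integral_mult_right)
  also have "\<dots> = (if \<bar>k\<bar> \<le> int N then c k * (2 * of_real pi) else 0)"
    by (auto simp: integral_fourier_mode if_distrib [of "\<lambda>z. _ * z"] abs_le_iff cong: if_cong)
  finally show ?thesis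
    by (simp add: fourier_coeff_def)
qed

text \<open>Canonical coefficients: along a solution they become definite functions of time that can
  be differentiated.\<close>

lemma trig_space_eq_coeff:
  assumes "f \<in> trig_space N"
  shows "f = trig_poly N (fourier_coeff f)"
proof -
  obtain c where f: "f = trig_poly N c"
    using assms by (auto simp: trig_space_eq_range)
  show ?thesis
    by (rule ext, subst f) (auto simp: trig_poly_def fourier_coeff_trig_poly f intro!: sum.cong)
qed

text \<open>The coefficients vanish for \<bar>k\<bar> > N, so the infinite sum is a finite one and
  no growth condition on the symbol arises.\<close>

lemma fourier_multiplier_trig_poly:
  "fourier_multiplier m (trig_poly N c) = trig_poly N (\<lambda>k. of_real (m k) * c k)"
proof
  fix x
  have "fourier_multiplier m (trig_poly N c) x =
      (\<Sum>\<^sub>\<infinity>k\<in>{-int N..int N}. of_real (m k) * c k * fourier_mode k x)"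
    unfolding fourier_multiplier_def
    by (rule infsum_cong_neutral) (auto simp: fourier_coeff_trig_poly abs_le_iff)
  then show "fourier_multiplier m (trig_poly N c) x = trig_poly N (\<lambda>k. of_real (m k) * c k) x"
    by (simp add: trig_poly_def)
qed

section \<open>Equispaced quadrature\<close>

text \<open>For k \<noteq> 0 this is a geometric sum over the powers of an M-th root of unity
  \<open>\<omega>\<close>. It vanishes unless \<open>\<omega> = 1\<close>, which would make k a
  multiple of M, impossible for 0 < \<bar>k\<bar> < M.\<close>

lemma sum_fourier_mode_equispaced:
  assumes "\<bar>k\<bar> < int M"
  shows "(\<Sum>j<M. fourier_mode k (2 * pi * real j / real M)) = (if k = 0 then of_nat M else 0)"
proof (cases "k = 0")
  case False
  define \<omega> where "\<omega> = exp (\<i> * of_int k * of_real (2 * pi / real M))"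
  have M: "M > 0" using assms by simp
  have "fourier_mode k (2 * pi * real j / real M) = \<omega> ^ j" for j
    by (simp add: \<omega>_def fourier_mode_def exp_of_nat_mult [symmetric] algebra_simps)
  moreover have "\<omega> ^ M = 1"
  proof -
    have "\<omega> ^ M = exp (2 * of_int k * of_real pi * \<i>)"
      using M by (simp add: \<omega>_def exp_of_nat_mult [symmetric] algebra_simps)
    also have "\<dots> = 1"
      using exp_integer_2pi [of "of_int k"] by (simp add: algebra_simps)
    finally show ?thesis .
  qed
  moreover have "\<omega> \<noteq> 1"
  proof
    assume "\<omega> = 1"
    then obtain n :: int where "real_of_int k * (2 * pi / real M) = of_int (2 * n) * pi"
      by (auto simp: \<omega>_def exp_eq_1)
    then have "real_of_int k = of_int (n * int M)"
      using M by (simp add: field_simps)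
    then have "k = n * int M"
      by (simp only: of_int_eq_iff)
    then have "int M dvd k" by simp
    then show False
      using assms False zdvd_not_zless [of "\<bar>k\<bar>" "int M"] by simp
  qed
  ultimately show ?thesis
    using False by (simp add: geometric_sum)
qed simp

text \<open>Both sides are linear in \<open>f\<close> and agree on each mode with \<bar>k\<bar>
  \<le> N < M, so the rule is exact.\<close>

lemma integral_trig_space_eq_quadrature:
  assumes "f \<in> trig_space N" and "N < M"
  shows "(LBINT x:{-pi..pi}. f x) =
    2 * of_real pi / of_nat M * (\<Sum>j<M. f (2 * pi * real j / real M))"
proof -
  obtain c where f: "f = trig_poly N c"
    using assms by (auto simp: trig_space_eq_range)
  have "(LBINT x:{-pi..pi}. f x) =
      (\<Sum>k\<in>{-int N..int N}. c k * (LBINT x:{-pi..pi}. fourier_mode k x))"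
    by (simp add: f trig_poly_def set_lebesgue_integral_sum set_integrable_continuous_period
        continuous_intros flip: set_integral_mult_right)
  also have "\<dots> = (\<Sum>k\<in>{-int N..int N}.
      c k * (2 * of_real pi / of_nat M * (\<Sum>j<M. fourier_mode k (2 * pi * real j / real M))))"
    using assms(2) by (intro sum.cong refl)
      (auto simp: integral_fourier_mode sum_fourier_mode_equispaced)
  also have "\<dots> = 2 * of_real pi / of_nat M *
      (\<Sum>k\<in>{-int N..int N}. \<Sum>j<M. c k * fourier_mode k (2 * pi * real j / real M))"
    by (simp add: sum_distrib_left algebra_simps)
  also have "(\<Sum>k\<in>{-int N..int N}. \<Sum>j<M. c k * fourier_mode k (2 * pi * real j / real M)) =
      (\<Sum>j<M. f (2 * pi * real j / real M))"
    unfolding f trig_poly_def by (rule sum.swap)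
  finally show ?thesis .
qed

text \<open>The integrand has degree at most 2N, hence 2N + 1 nodes. A coefficient is thus a fixed
  linear combination of finitely many point values, through which pointwise time derivatives
  pass.\<close>

lemma fourier_coeff_eq_quadrature:
  assumes "f \<in> trig_space N" and "\<bar>k\<bar> \<le> int N"
  shows "fourier_coeff f k = 1 / of_nat (2 * N + 1) *
    (\<Sum>j<2 * N + 1. f (2 * pi * real j / real (2 * N + 1)) *
                       fourier_mode (- k) (2 * pi * real j / real (2 * N + 1)))"
proof -
  have "(\<lambda>x. f x * fourier_mode (- k) x) \<in> trig_space (N + N)"
    using assms trig_space_mode [of "- k" N 1] by (intro trig_space_mult) auto
  from integral_trig_space_eq_quadrature [OF this, of "2 * N + 1"]
  show ?thesis
    by (simp add: fourier_coeff_def fourier_mode_def)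
qed

section \<open>The invariants on trigonometric polynomials\<close>

lemma I1_trig_poly:
  "I1 (trig_poly N c) = pi * (\<Sum>k\<in>{-int N..int N}. (cmod (c k))\<^sup>2)"
proof -
  have "complex_of_real (I1 (trig_poly N c)) = 1 / 2 * L2_inner (trig_poly N c) (trig_poly N c)"
    by (simp add: I1_def L2_inner_def
        flip: complex_norm_square set_integral_complex_of_real)
  also have "\<dots> = of_real (pi * (\<Sum>k\<in>{-int N..int N}. (cmod (c k))\<^sup>2))"
    by (simp add: L2_inner_trig_poly flip: complex_norm_square)
  finally show ?thesis
    by (simp only: of_real_eq_iff)
qed

text \<open>With u = v + iw, the density v w_x - w v_x is the imaginary part of u_x times the
  conjugate of u; Parseval then applies with the coefficients i k c_k of u_x.\<close>

lemma I2_trig_poly: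
  "I2 (trig_poly N c) = pi * (\<Sum>k\<in>{-int N..int N}. of_int k * (cmod (c k))\<^sup>2)"
proof -
  define u where "u = trig_poly N c"
  define ux where "ux = trig_poly N (\<lambda>k. \<i> * of_int k * c k)"
  have "((\<lambda>x. Re (u x)) has_real_derivative Re (ux x)) (at x)"
       "((\<lambda>x. Im (u x)) has_real_derivative Im (ux x)) (at x)" for x
    using has_vector_derivative_trig_poly [of N c x UNIV]
    by (auto simp: u_def ux_def has_vector_derivative_complex_iff)
  then have "deriv (\<lambda>x. Re (u x)) x = Re (ux x)" "deriv (\<lambda>x. Im (u x)) x = Im (ux x)" for x
    by (auto intro: DERIV_imp_deriv)
  then have "I2 u = 1 / 2 * (LBINT x:{-pi..pi}. Im (ux x * cnj (u x)))"
    by (simp add: I2_def algebra_simps)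
  also have "(LBINT x:{-pi..pi}. Im (ux x * cnj (u x))) = Im (L2_inner ux u)"
    unfolding L2_inner_def u_def ux_def
    by (intro set_lebesgue_integral_bounded_linear bounded_linear_Im
        set_integrable_continuous_period continuous_intros)
  also have "\<dots> = 2 * pi * (\<Sum>k\<in>{-int N..int N}. of_int k * (cmod (c k))\<^sup>2)"
    unfolding u_def ux_def L2_inner_trig_poly
    by (simp add: mult.assoc flip: complex_norm_square)
  finally show ?thesis
    by (simp add: u_def)
qed

text \<open>The symbol is real and even, so the operator commutes with conjugation and maps Re u and
  Im u to the real and imaginary parts of \<bar>D\<bar>^s u. The sum of squares is then a squared
  modulus.\<close>

lemma abs_D_Re_Im_trig_poly:
  "(abs_D s (\<lambda>x. of_real (Re (trig_poly N c x))) x)\<^sup>2 +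
   (abs_D s (\<lambda>x. of_real (Im (trig_poly N c x))) x)\<^sup>2 =
   abs_D s (trig_poly N c) x * cnj (abs_D s (trig_poly N c) x)"
proof -
  \<comment> \<open>Coefficients of the conjugate polynomial.\<close>
  define d where "d k = cnj (c (- k))" for k
  define m where "m k = complex_of_real (\<bar>of_int k\<bar> powr s)" for k :: int
  have Re: "(\<lambda>x. complex_of_real (Re (trig_poly N c x))) =
      trig_poly N (\<lambda>k. 1 / 2 * c k + 1 / 2 * d k)"
    by (rule ext)
      (simp only: trig_poly_lincomb [symmetric] d_def cnj_trig_poly [symmetric],
       simp add: complex_eq_iff)
  have Im: "(\<lambda>x. complex_of_real (Im (trig_poly N c x))) =
      trig_poly N (\<lambda>k. - \<i> / 2 * c k + \<i> / 2 * d k)"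
    by (rule ext)
      (simp only: trig_poly_lincomb [symmetric] d_def cnj_trig_poly [symmetric],
       simp add: complex_eq_iff)
  define A B where "A = trig_poly N (\<lambda>k. m k * c k) x" and "B = trig_poly N (\<lambda>k. m k * d k) x"
  have "abs_D s (\<lambda>x. of_real (Re (trig_poly N c x))) x = 1 / 2 * A + 1 / 2 * B"
    unfolding A_def B_def trig_poly_lincomb abs_D_def Re fourier_multiplier_trig_poly m_def
    by (simp add: algebra_simps)
  moreover have "abs_D s (\<lambda>x. of_real (Im (trig_poly N c x))) x = - \<i> / 2 * A + \<i> / 2 * B"
    unfolding A_def B_def trig_poly_lincomb abs_D_def Im fourier_multiplier_trig_poly m_def
    by (simp add: algebra_simps)
  moreover have "abs_D s (trig_poly N c) x = A"
    by (simp add: A_def abs_D_def fourier_multiplier_trig_poly m_def)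
  moreover have "cnj A = B"
    by (simp add: A_def B_def cnj_trig_poly m_def d_def)
  \<comment> \<open>With \<open>B\<close> the conjugate of \<open>A\<close>, the two terms are the
    squares of (A + B)/2 and (A - B)/(2i).\<close>
  moreover have "(1 / 2 * A + 1 / 2 * B)\<^sup>2 + (- \<i> / 2 * A + \<i> / 2 * B)\<^sup>2 = A * B"
  proof -
    have "(- \<i> / 2 * A + \<i> / 2 * B)\<^sup>2 = \<i>\<^sup>2 * ((B - A) / 2)\<^sup>2"
      unfolding power_mult_distrib [symmetric] by (simp add: algebra_simps diff_divide_distrib)
    then show ?thesis
      by (simp add: power2_eq_square field_simps)
  qed
  ultimately show ?thesis
    by simp
qed

text \<open>Parseval for \<bar>D\<bar>^s u squares the symbol to \<bar>k\<bar>^(2s); the factor 1/4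
  is the 1/2 of the energy times the 1/2 in \<open>V\<close>.\<close>

lemma energy_trig_poly:
  "energy s (trig_poly N c) = of_real
     (pi * (\<Sum>k\<in>{-int N..int N}. \<bar>of_int k\<bar> powr (2 * s) * (cmod (c k))\<^sup>2)
      - 1 / 4 * (LBINT x:{-pi..pi}. cmod (trig_poly N c x) ^ 4))"
proof -
  define u where "u = trig_poly N c"
  define Du where "Du = trig_poly N (\<lambda>k. of_real (\<bar>of_int k\<bar> powr s) * c k)"
  have "energy s u = 1 / 2 * (LBINT x:{-pi..pi}. Du x * cnj (Du x) - of_real (V (u x)))"
    by (simp add: energy_def u_def abs_D_Re_Im_trig_poly)
      (simp add: Du_def abs_D_def fourier_multiplier_trig_poly)
  also have "(LBINT x:{-pi..pi}. Du x * cnj (Du x) - of_real (V (u x))) =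
      L2_inner Du Du - (LBINT x:{-pi..pi}. of_real (V (u x)))"
    unfolding L2_inner_def V_def Du_def u_def
    by (intro set_integral_diff set_integrable_continuous_period continuous_intros) auto
  also have "(LBINT x:{-pi..pi}. complex_of_real (V (u x))) =
      of_real (1 / 2 * (LBINT x:{-pi..pi}. cmod (u x) ^ 4))"
    unfolding set_integral_complex_of_real by (simp add: V_def)
  also have "L2_inner Du Du = of_real (2 * pi *
      (\<Sum>k\<in>{-int N..int N}. \<bar>of_int k\<bar> powr (2 * s) * (cmod (c k))\<^sup>2))"
  proof -
    have "(\<bar>real_of_int k\<bar> powr s)\<^sup>2 = \<bar>of_int k\<bar> powr (2 * s)" for k
      by (simp add: power2_eq_square powr_add [symmetric])
    then show ?thesis
      unfolding Du_def L2_inner_trig_poly complex_norm_square [symmetric]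
      by (simp add: norm_mult power_mult_distrib)
  qed
  finally show ?thesis
    by (simp add: u_def algebra_simps)
qed

section \<open>Derivatives of powers of the modulus, and pairings with the cubic term\<close>

lemma has_real_derivative_cmod_power2:
  assumes "(f has_vector_derivative f') (at t within S)"
  shows "((\<lambda>\<tau>. (cmod (f \<tau>))\<^sup>2) has_real_derivative 2 * Re (f' * cnj (f t))) (at t within S)"
proof -
  have Re: "((\<lambda>\<tau>. Re (f \<tau>)) has_real_derivative Re f') (at t within S)"
    and Im: "((\<lambda>\<tau>. Im (f \<tau>)) has_real_derivative Im f') (at t within S)"
    using has_vector_derivative_complex_iff [of f f' "at t within S"] assms by blast+
  show ?thesis
    unfolding cmod_power2
    using DERIV_add [OF DERIV_power [OF Re, of 2] DERIV_power [OF Im, of 2]]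
    by (simp add: algebra_simps)
qed

text \<open>Conjugating the derivative rather than \<open>f\<close> gives the integrand of the
  pairing of \<bar>u\<bar>^2 u with a derivative of u, in time or in space.\<close>

lemma has_real_derivative_cmod_power4:
  assumes "(f has_vector_derivative f') (at t within S)"
  shows "((\<lambda>\<tau>. cmod (f \<tau>) ^ 4) has_real_derivative
    4 * Re (of_real ((cmod (f t))\<^sup>2) * f t * cnj f')) (at t within S)"
proof -
  have "((\<lambda>\<tau>. ((cmod (f \<tau>))\<^sup>2)\<^sup>2) has_real_derivative
      4 * Re (of_real ((cmod (f t))\<^sup>2) * f t * cnj f')) (at t within S)"
    using DERIV_power [OF has_real_derivative_cmod_power2 [OF assms], of 2]
    by (simp add: algebra_simps flip: of_real_power)
  then show ?thesis
    by simp
qed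

text \<open>The integrand is \<bar>u\<bar>^4, which is real.\<close>

lemma Im_L2_inner_cubic_self:
  "Im (L2_inner (\<lambda>x. of_real ((cmod (trig_poly N c x))\<^sup>2) * trig_poly N c x) (trig_poly N c)) = 0"
proof -
  have "L2_inner (\<lambda>x. of_real ((cmod (trig_poly N c x))\<^sup>2) * trig_poly N c x) (trig_poly N c) =
      (LBINT x:{-pi..pi}. complex_of_real ((cmod (trig_poly N c x))\<^sup>2 * (cmod (trig_poly N c x))\<^sup>2))"
    by (simp add: L2_inner_def mult.assoc flip: complex_norm_square)
  then show ?thesis
    by (simp only: set_integral_complex_of_real Im_complex_of_real)
qed

text \<open>The imaginary part of the integrand is the derivative of the periodic function \<open>\<bar>u\<bar>\<^sup>4 / 4\<close>.\<close>

lemma Im_L2_inner_cubic_momentum: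
  "Im (L2_inner (\<lambda>x. of_real ((cmod (trig_poly N c x))\<^sup>2) * trig_poly N c x)
         (trig_poly N (\<lambda>k. of_int k * c k))) = 0"
proof -
  define u where "u = trig_poly N c"
  define p where "p = trig_poly N (\<lambda>k. of_int k * c k)"
  define ux where "ux = trig_poly N (\<lambda>k. \<i> * of_int k * c k)"
  have ux: "ux x = \<i> * p x" for x
    by (simp add: ux_def p_def trig_poly_def sum_distrib_left algebra_simps)
  have cont: "continuous_on A u" "continuous_on A p" for A
    by (auto simp: u_def p_def intro: continuous_on_trig_poly)
  have "((\<lambda>x. 1 / 4 * cmod (u x) ^ 4) has_real_derivative
      Im (of_real ((cmod (u x))\<^sup>2) * u x * cnj (p x))) (at x within A)" for x A
  proof -
    have "(u has_vector_derivative ux x) (at x within A)"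
      unfolding u_def ux_def by (rule has_vector_derivative_trig_poly)
    from DERIV_cmult [OF has_real_derivative_cmod_power4 [OF this], of "1 / 4"]
    show ?thesis
      by (simp add: ux algebra_simps flip: of_real_power)
  qed
  then have "(LBINT x:{-pi..pi}. Im (of_real ((cmod (u x))\<^sup>2) * u x * cnj (p x))) =
      1 / 4 * cmod (u pi) ^ 4 - 1 / 4 * cmod (u (- pi)) ^ 4"
    unfolding set_lebesgue_integral_def
    by (intro integral_FTC_atLeastAtMost continuous_intros cont)
      (auto simp: has_real_derivative_iff_has_vector_derivative)
  also have "u pi = u (- pi)"
    by (simp add: u_def trig_poly_def fourier_mode_pi)
  finally show ?thesis
    unfolding L2_inner_def u_def [symmetric] p_def [symmetric]
    by (subst set_lebesgue_integral_bounded_linear [OF bounded_linear_Im, symmetric])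
      (auto intro!: set_integrable_continuous_period continuous_intros cont)
qed

section \<open>The Galerkin system\<close>

text \<open>Passes from pointwise derivatives to coefficients, and shows that u_t lies in S_N, hence
  is an admissible test function. Since \<open>t\<close> is not isolated in \<open>J\<close>, the
  time derivative is unique.\<close>

lemma galerkin_coefficients:
  assumes sol: "galerkin_solution s N u0 J u" and t: "t \<in> J" and nt: "at t within J \<noteq> bot"
  obtains d where
    "\<And>k. \<bar>k\<bar> \<le> int N \<Longrightarrow>
       ((\<lambda>\<tau>. fourier_coeff (u \<tau>) k) has_vector_derivative d k) (at t within J)"
    "\<And>x. ((\<lambda>\<tau>. u \<tau> x) has_vector_derivative trig_poly N d x) (at t within J)"
    "\<And>b. 2 * of_real pi * (\<Sum>k\<in>{-int N..int N}.
            (\<i> * d k - of_real (\<bar>of_int k\<bar> powr (2 * s)) * fourier_coeff (u t) k) * cnj (b k))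
          + L2_inner (\<lambda>x. of_real ((cmod (u t x))\<^sup>2) * u t x) (trig_poly N b) = 0"
proof -
  define c where "c \<tau> = fourier_coeff (u \<tau>)" for \<tau>
  define M where "M = 2 * N + 1"
  obtain u' where u': "\<And>x. ((\<lambda>\<tau>. u \<tau> x) has_vector_derivative u' x) (at t within J)"
    and eq: "\<And>\<phi>. \<phi> \<in> trig_space N \<Longrightarrow> L2_inner (\<lambda>x. \<i> * u' x - frac_laplacian s (u t) x
                            + of_real ((cmod (u t x))\<^sup>2) * u t x) \<phi> = 0"
    using sol t unfolding galerkin_solution_def by (elim conjE exE) blast
  have space: "u \<tau> \<in> trig_space N" if "\<tau> \<in> J" for \<tau>
    using sol that by (auto simp: galerkin_solution_def)
  have u: "u \<tau> = trig_poly N (c \<tau>)" if "\<tau> \<in> J" for \<tau>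
    using trig_space_eq_coeff [OF space [OF that]] by (simp add: c_def)
  \<comment> \<open>The quadrature formula for the k-th coefficient, applied to \<open>u'\<close>.
    As \<open>u'\<close> is not yet known to lie in S_N, \<open>d k\<close> cannot yet be read as
    its Fourier coefficient.\<close>
  define d where "d k = 1 / of_nat M * (\<Sum>j<M. u' (2 * pi * real j / real M) *
                       fourier_mode (- k) (2 * pi * real j / real M))" for k
  have c': "((\<lambda>\<tau>. c \<tau> k) has_vector_derivative d k) (at t within J)" if k: "\<bar>k\<bar> \<le> int N" for k
  proof (rule has_vector_derivative_transform [OF t])
    show "((\<lambda>\<tau>. 1 / of_nat M * (\<Sum>j<M. u \<tau> (2 * pi * real j / real M) *
        fourier_mode (- k) (2 * pi * real j / real M))) has_vector_derivative d k) (at t within J)"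
      unfolding d_def
      by (intro has_vector_derivative_mult_right has_vector_derivative_sum
          has_vector_derivative_mult_left u')
  qed (simp add: c_def M_def fourier_coeff_eq_quadrature [OF space k] del: of_nat_add of_nat_mult)
  \<comment> \<open>Both sides are derivatives of the same function of time at \<open>t\<close>, so
    uniqueness places \<open>u'\<close> in S_N.\<close>
  have u'_eq: "u' x = trig_poly N d x" for x
  proof -
    have "((\<lambda>\<tau>. trig_poly N (c \<tau>) x) has_vector_derivative trig_poly N d x) (at t within J)"
      unfolding trig_poly_def
      by (intro has_vector_derivative_sum has_vector_derivative_mult_left c') auto
    then have "((\<lambda>\<tau>. u \<tau> x) has_vector_derivative trig_poly N d x) (at t within J)"
      by (rule has_vector_derivative_transform [OF t, rotated]) (simp add: u)
    with nt u' show ?thesis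
      by (rule vector_derivative_unique_within)
  qed
  show thesis
  proof
    show "((\<lambda>\<tau>. fourier_coeff (u \<tau>) k) has_vector_derivative d k) (at t within J)"
      if "\<bar>k\<bar> \<le> int N" for k
      using c' [OF that] by (simp add: c_def)
    show "((\<lambda>\<tau>. u \<tau> x) has_vector_derivative trig_poly N d x) (at t within J)" for x
      using u' by (simp add: u'_eq)
    fix b
    \<comment> \<open>\<open>A\<close> is the linear part of the residual and lies in S_N, so
      Parseval applies to it; the cubic part \<open>G\<close> need not lie in S_N and stays inside
      the integral.\<close>
    define A where "A = trig_poly N (\<lambda>k. \<i> * d k - of_real (\<bar>of_int k\<bar> powr (2 * s)) * c t k)"
    define G where "G x = of_real ((cmod (u t x))\<^sup>2) * u t x" for x
    have "A x = \<i> * u' x - frac_laplacian s (u t) x" for x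
      unfolding A_def u'_eq u [OF t] frac_laplacian_def fourier_multiplier_trig_poly trig_poly_def
      by (simp add: sum_distrib_left sum_subtractf algebra_simps)
    then have "L2_inner (\<lambda>x. A x + G x) (trig_poly N b) = 0"
      using eq [OF trig_poly_in_trig_space [of N b]] by (simp add: G_def)
    also have "L2_inner (\<lambda>x. A x + G x) (trig_poly N b) =
        L2_inner A (trig_poly N b) + L2_inner G (trig_poly N b)"
      unfolding L2_inner_def distrib_right A_def G_def u [OF t]
      by (intro set_integral_add set_integrable_continuous_period continuous_intros)
    finally show "2 * of_real pi * (\<Sum>k\<in>{-int N..int N}.
            (\<i> * d k - of_real (\<bar>of_int k\<bar> powr (2 * s)) * fourier_coeff (u t) k) * cnj (b k))
          + L2_inner (\<lambda>x. of_real ((cmod (u t x))\<^sup>2) * u t x) (trig_poly N b) = 0"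
      by (simp add: A_def G_def [abs_def] c_def L2_inner_trig_poly)
  qed
qed

section \<open>Time derivatives of the quadratic forms and of the quartic integral\<close>

lemma has_real_derivative_quadratic_form:
  assumes "\<And>k. k \<in> K \<Longrightarrow> ((\<lambda>\<tau>. c \<tau> k) has_vector_derivative d k) (at t within S)"
  shows "((\<lambda>\<tau>. pi * (\<Sum>k\<in>K. m k * (cmod (c \<tau> k))\<^sup>2)) has_real_derivative
     2 * pi * (\<Sum>k\<in>K. m k * Re (d k * cnj (c t k)))) (at t within S)"
proof -
  have "((\<lambda>\<tau>. pi * (\<Sum>k\<in>K. m k * (cmod (c \<tau> k))\<^sup>2)) has_real_derivative
     pi * (\<Sum>k\<in>K. m k * (2 * Re (d k * cnj (c t k))))) (at t within S)"
    by (intro DERIV_cmult DERIV_sum has_real_derivative_cmod_power2 assms)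
  then show ?thesis
    by (simp add: sum_distrib_left algebra_simps)
qed

text \<open>Exact quadrature replaces differentiation under the integral sign: the integral is a
  finite sum of point values, which is differentiated termwise and then turned back into an
  integral.\<close>

lemma has_real_derivative_quartic_integral:
  assumes space: "\<And>\<tau>. \<tau> \<in> S \<Longrightarrow> u \<tau> \<in> trig_space N" and u': "u' \<in> trig_space N" and t: "t \<in> S"
    and deriv: "\<And>x. ((\<lambda>\<tau>. u \<tau> x) has_vector_derivative u' x) (at t within S)"
  shows "((\<lambda>\<tau>. LBINT x:{-pi..pi}. cmod (u \<tau> x) ^ 4) has_real_derivative
     4 * Re (L2_inner (\<lambda>x. of_real ((cmod (u t x))\<^sup>2) * u t x) u')) (at t within S)"
proof -
  \<comment> \<open>A product of four factors of degree N has degree at most 4N, so 4N + 1 nodes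
    suffice.\<close>
  define M where "M = 4 * N + 1"
  define y where "y j = 2 * pi * real j / real M" for j
  \<comment> \<open>Four separate factors allow two uses: all equal to u for the integral of
    \<bar>u\<bar>^4, and the last one replaced by \<open>u'\<close> for its derivative.\<close>
  have quad: "(LBINT x:{-pi..pi}. f1 x * cnj (f2 x) * (f3 x * cnj (f4 x))) =
      of_real (2 * pi / real M) * (\<Sum>j<M. f1 (y j) * cnj (f2 (y j)) * (f3 (y j) * cnj (f4 (y j))))"
    if "f1 \<in> trig_space N" "f2 \<in> trig_space N" "f3 \<in> trig_space N" "f4 \<in> trig_space N"
    for f1 f2 f3 f4
  proof -
    have "(\<lambda>x. f1 x * cnj (f2 x) * (f3 x * cnj (f4 x))) \<in> trig_space ((N + N) + (N + N))"
      by (intro trig_space_mult trig_space_cnj that)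
    from integral_trig_space_eq_quadrature [OF this, of M] show ?thesis
      by (simp add: M_def y_def)
  qed
  have integral_eq: "(LBINT x:{-pi..pi}. cmod (u \<tau> x) ^ 4) = 2 * pi / real M * (\<Sum>j<M. cmod (u \<tau> (y j)) ^ 4)"
    if "\<tau> \<in> S" for \<tau>
  proof -
    have *: "z * cnj z * (z * cnj z) = complex_of_real (cmod z ^ 4)" for z
      unfolding complex_norm_square [symmetric] by (simp flip: power_add)
    have "complex_of_real (LBINT x:{-pi..pi}. cmod (u \<tau> x) ^ 4) =
        complex_of_real (2 * pi / real M * (\<Sum>j<M. cmod (u \<tau> (y j)) ^ 4))"
      using quad [of "u \<tau>" "u \<tau>" "u \<tau>" "u \<tau>"] space [OF that]
      unfolding * set_integral_complex_of_real by simp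
    then show ?thesis by (simp only: of_real_eq_iff)
  qed
  define D where "D = 2 * pi / real M *
      (\<Sum>j<M. 4 * Re (of_real ((cmod (u t (y j)))\<^sup>2) * u t (y j) * cnj (u' (y j))))"
  have "((\<lambda>\<tau>. 2 * pi / real M * (\<Sum>j<M. cmod (u \<tau> (y j)) ^ 4)) has_real_derivative D)
      (at t within S)"
    unfolding D_def by (intro DERIV_cmult DERIV_sum has_real_derivative_cmod_power4 deriv)
  then have "((\<lambda>\<tau>. LBINT x:{-pi..pi}. cmod (u \<tau> x) ^ 4) has_real_derivative D) (at t within S)"
    unfolding has_real_derivative_iff_has_vector_derivative
    by (rule has_vector_derivative_transform [OF t, rotated]) (rule integral_eq)
  moreover have "L2_inner (\<lambda>x. of_real ((cmod (u t x))\<^sup>2) * u t x) u' = of_real (2 * pi / real M) *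
      (\<Sum>j<M. of_real ((cmod (u t (y j)))\<^sup>2) * u t (y j) * cnj (u' (y j)))"
    using quad [of "u t" "u t" "u t" u'] space [OF t] u'
    unfolding L2_inner_def complex_norm_square [symmetric] by (simp only: mult.assoc)
  then have "D = 4 * Re (L2_inner (\<lambda>x. of_real ((cmod (u t x))\<^sup>2) * u t x) u')"
    by (simp only: D_def Re_complex_of_real Im_complex_of_real times_complex.sel Re_sum
        sum_distrib_left [symmetric]) simp
  ultimately show ?thesis
    by simp
qed

section \<open>Conservation of mass, momentum and energy\<close>

theorem proposition2p1:
  fixes s :: real and N :: nat and u0 :: "real \<Rightarrow> complex"
    and J :: "real set" and u :: "real \<Rightarrow> real \<Rightarrow> complex"
  assumes "0 < s" and "s \<le> 1" and "1 \<le> N"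
    and "smooth u0" and "periodic_2pi u0"
    and "galerkin_solution s N u0 J u"
  shows "\<forall>t\<in>J. ((\<lambda>\<tau>. I1 (u \<tau>)) has_real_derivative 0) (at t within J) \<and>
               ((\<lambda>\<tau>. I2 (u \<tau>)) has_real_derivative 0) (at t within J) \<and>
               ((\<lambda>\<tau>. energy s (u \<tau>)) has_vector_derivative 0) (at t within J)"
proof
  fix t assume t: "t \<in> J"
  show "((\<lambda>\<tau>. I1 (u \<tau>)) has_real_derivative 0) (at t within J) \<and>
        ((\<lambda>\<tau>. I2 (u \<tau>)) has_real_derivative 0) (at t within J) \<and>
        ((\<lambda>\<tau>. energy s (u \<tau>)) has_vector_derivative 0) (at t within J)"
  proof (cases "at t within J = bot")
    \<comment> \<open>Here \<open>t\<close> is an isolated point, so the interval \<open>J\<close>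
      is a single point and every derivative statement at \<open>t\<close> holds trivially.\<close>
    case True
    then show ?thesis
      by (simp add: has_field_derivative_def has_vector_derivative_def has_derivative_def
          bounded_linear_zero bounded_linear_mult_right)
  next
    case False
    define K where "K = {-int N..int N}"
    define c where "c \<tau> = fourier_coeff (u \<tau>)" for \<tau>
    define G where "G x = of_real ((cmod (u t x))\<^sup>2) * u t x" for x
    define \<Lambda> where "\<Lambda> k = \<bar>real_of_int k\<bar> powr (2 * s)" for k
    obtain d where c': "\<And>k. k \<in> K \<Longrightarrow> ((\<lambda>\<tau>. c \<tau> k) has_vector_derivative d k) (at t within J)"
      and u': "\<And>x. ((\<lambda>\<tau>. u \<tau> x) has_vector_derivative trig_poly N d x) (at t within J)"
      and weak: "\<And>b. 2 * of_real pi * (\<Sum>k\<in>K. (\<i> * d k - of_real (\<Lambda> k) * c t k) * cnj (b k))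
          + L2_inner G (trig_poly N b) = 0"
    proof (rule galerkin_coefficients [OF assms(6) t False])
      fix d
      assume "\<And>k. \<bar>k\<bar> \<le> int N \<Longrightarrow>
          ((\<lambda>\<tau>. fourier_coeff (u \<tau>) k) has_vector_derivative d k) (at t within J)"
        and "\<And>x. ((\<lambda>\<tau>. u \<tau> x) has_vector_derivative trig_poly N d x) (at t within J)"
        and "\<And>b. 2 * of_real pi * (\<Sum>k\<in>{-int N..int N}.
            (\<i> * d k - of_real (\<bar>of_int k\<bar> powr (2 * s)) * fourier_coeff (u t) k) * cnj (b k))
          + L2_inner (\<lambda>x. of_real ((cmod (u t x))\<^sup>2) * u t x) (trig_poly N b) = 0"
      then show thesis
        by (intro that [of d]) (auto simp: K_def c_def G_def [abs_def] \<Lambda>_def abs_le_iff)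
    qed
    have space: "u \<tau> \<in> trig_space N" if "\<tau> \<in> J" for \<tau>
      using assms(6) that by (auto simp: galerkin_solution_def)
    have u: "u \<tau> = trig_poly N (c \<tau>)" if "\<tau> \<in> J" for \<tau>
      using trig_space_eq_coeff [OF space [OF that]] by (simp add: c_def)

    \<comment> \<open>Test with the polynomial whose coefficients are \<open>m k * c t k\<close> and take imaginary parts.\<close>
    have quadratic: "((\<lambda>\<tau>. pi * (\<Sum>k\<in>K. m k * (cmod (c \<tau> k))\<^sup>2)) has_real_derivative 0) (at t within J)"
      if "Im (L2_inner G (trig_poly N (\<lambda>k. of_real (m k) * c t k))) = 0" for m
    proof -
      \<comment> \<open>The dispersive term contributes a real multiple of \<bar>c_k\<bar>^2, which
        has no imaginary part; only the time derivative remains.\<close>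
      have "Im ((\<i> * d k - of_real (\<Lambda> k) * c t k) * cnj (of_real (m k) * c t k)) =
          m k * Re (d k * cnj (c t k))" for k
        by (simp add: algebra_simps)
      then have "2 * pi * (\<Sum>k\<in>K. m k * Re (d k * cnj (c t k))) = Im (2 * of_real pi *
          (\<Sum>k\<in>K. (\<i> * d k - of_real (\<Lambda> k) * c t k) * cnj (of_real (m k) * c t k)))"
        by (simp only: mult.assoc Im_complex_of_real Re_complex_of_real Im_sum times_complex.sel
            complex_Re_numeral complex_Im_numeral) simp
      also have "\<dots> = 0"
        using that arg_cong [OF weak [of "\<lambda>k. of_real (m k) * c t k"], of Im] by simp
      finally show ?thesis
        using has_real_derivative_quadratic_form [of K c d t J m, OF c'] by simp
    qed

    have "((\<lambda>\<tau>. I1 (u \<tau>)) has_real_derivative 0) (at t within J)"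
    proof -
      \<comment> \<open>Weights 1: the test function is u itself.\<close>
      have "((\<lambda>\<tau>. pi * (\<Sum>k\<in>K. 1 * (cmod (c \<tau> k))\<^sup>2)) has_real_derivative 0) (at t within J)"
        using Im_L2_inner_cubic_self [of N "c t"]
        by (intro quadratic) (simp add: G_def [abs_def] u [OF t])
      then show ?thesis
        unfolding has_real_derivative_iff_has_vector_derivative
        by (rule has_vector_derivative_transform [OF t, rotated]) (simp add: u I1_trig_poly K_def)
    qed
    moreover have "((\<lambda>\<tau>. I2 (u \<tau>)) has_real_derivative 0) (at t within J)"
    proof -
      \<comment> \<open>Weights k: the test function is -i u_x.\<close>
      have "((\<lambda>\<tau>. pi * (\<Sum>k\<in>K. of_int k * (cmod (c \<tau> k))\<^sup>2)) has_real_derivative 0) (at t within J)"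
        using Im_L2_inner_cubic_momentum [of N "c t"]
        by (intro quadratic) (simp add: G_def [abs_def] u [OF t])
      then show ?thesis
        unfolding has_real_derivative_iff_has_vector_derivative
        by (rule has_vector_derivative_transform [OF t, rotated]) (simp add: u I2_trig_poly K_def)
    qed
    moreover have "((\<lambda>\<tau>. energy s (u \<tau>)) has_vector_derivative 0) (at t within J)"
    proof -
      define Q where "Q \<tau> = (LBINT x:{-pi..pi}. cmod (u \<tau> x) ^ 4)" for \<tau>
      define E where "E \<tau> = pi * (\<Sum>k\<in>K. \<Lambda> k * (cmod (c \<tau> k))\<^sup>2) - 1 / 4 * Q \<tau>" for \<tau>
      \<comment> \<open>Test with u_t, whose coefficients are \<open>d\<close>, and take real parts:
        the term i \<bar>d_k\<bar>^2 is imaginary and drops out.\<close>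
      have "Re ((\<i> * d k - of_real (\<Lambda> k) * c t k) * cnj (d k)) =
          - (\<Lambda> k * Re (d k * cnj (c t k)))" for k
        by (simp add: algebra_simps)
      then have "Re (2 * of_real pi * (\<Sum>k\<in>K. (\<i> * d k - of_real (\<Lambda> k) * c t k) * cnj (d k))) =
          - (2 * pi * (\<Sum>k\<in>K. \<Lambda> k * Re (d k * cnj (c t k))))"
        by (simp only: mult.assoc Im_complex_of_real Re_complex_of_real Re_sum times_complex.sel
            complex_Re_numeral complex_Im_numeral) (simp add: sum_negf)
      \<comment> \<open>The left side is the rate of change of the kinetic part, the right side that
        of Q/4, so they cancel in the derivative of \<open>E\<close>.\<close>
      then have "2 * pi * (\<Sum>k\<in>K. \<Lambda> k * Re (d k * cnj (c t k)))
          = Re (L2_inner G (trig_poly N d))"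
        using arg_cong [OF weak [of d], of Re] by simp
      moreover have "(E has_real_derivative
          2 * pi * (\<Sum>k\<in>K. \<Lambda> k * Re (d k * cnj (c t k)))
          - 1 / 4 * (4 * Re (L2_inner G (trig_poly N d)))) (at t within J)"
        unfolding E_def [abs_def] Q_def G_def [abs_def]
        by (intro DERIV_diff DERIV_cmult has_real_derivative_quadratic_form c'
            has_real_derivative_quartic_integral [OF space trig_poly_in_trig_space t u'])
      ultimately have "(E has_real_derivative 0) (at t within J)"
        by simp
      then have "((\<lambda>\<tau>. complex_of_real (E \<tau>)) has_vector_derivative of_real 0) (at t within J)"
        by (rule has_vector_derivative_of_real)
      then have "((\<lambda>\<tau>. complex_of_real (E \<tau>)) has_vector_derivative 0) (at t within J)"
        by simp
      then show ?thesis
        by (rule has_vector_derivative_transform [OF t, rotated])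
          (simp only: u energy_trig_poly E_def Q_def K_def \<Lambda>_def)
    qed
    ultimately show ?thesis by blast
  qed
qed

end
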